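(* There exists a partition of the non-negative integers into three sets $A=\{a_k\mid k\ge 1\}$, $B=\{b_k\mid k\ge 1\}$, $C=\{c_k\mid k\ge 1\}$ with $$(a_1,a_2,a_3,a_4,a_5)=(0,3,6,8,9),\quad (b_1,b_2,b_3,b_4,b_5)=(1,4,7,11,14),\quad (c_1,c_2,c_3,c_4)=(2,5,10,13),$$ which is equivalent to the standard partition.
   Context: A partition of the non-negative integers into three sets $A,B,C$ is considered together with enumerations without repetition $A=\{a_k\mid k\ge 1\}$, $B=\{b_k\mid k\ge 1\}$, $C=\{c_k\mid k\ge 1\}$ (not required to be increasing): every non-negative integer occurs exactly once among the $a_k,b_k,c_k$. The element $a_k$ (resp. $b_k$, $c_k$) is the element of rank $k$. The standard partition of the non-negative integers is given by the three sets, enumerated by $n\ge 1$, $$S_1=\{3n-\lfloor n/2\rfloor-2\mid n\ge 1\},\quad S_2=\{3n-\lfloor n/2\rfloor-1\mid n\ge 1\},\quad S_3=\{5n-5\mid n\ge 1\}.$$ Two partitions $A=\{a_k\},B=\{b_k\},C=\{c_k\}$ and $D=\{d_k\},E=\{e_k\},F=\{f_k\}$ ($k\ge 1$) of the non-negative integers are equivalent if there exists a number $N$ such that $a_k=d_k$, $b_k=e_k$ and $c_k=f_k$ for all $k>N$. The problem being solved: the non-negative integers are divided into three groups $A=\{0,3,6,8,9,\ldots\}$, $B=\{1,4,7,11,14,\ldots\}$, $C=\{2,5,10,13,\ldots\}$; a solution is a completion of these lists to a partition. *)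

theory Defs
  imports Main
begin

text \<open>Ranks start at 1: a sequence \<open>a :: nat \<Rightarrow> nat\<close> stands for the enumeration
  \<open>a 1, a 2, \<dots>\<close>, and the value \<open>a 0\<close> is irrelevant.  Enumerations need not be increasing.\<close>

definition enumerates :: "(nat \<Rightarrow> nat) \<Rightarrow> nat set \<Rightarrow> bool" where
  "enumerates a A \<longleftrightarrow> bij_betw a {1..} A"

definition partition3 :: "nat set \<Rightarrow> nat set \<Rightarrow> nat set \<Rightarrow> bool" where
  "partition3 A B C \<longleftrightarrow> A \<union> B \<union> C = UNIV \<and> A \<inter> B = {} \<and> A \<inter> C = {} \<and> B \<inter> C = {}"

definition enumerated_partition ::
    "(nat \<Rightarrow> nat) \<times> (nat \<Rightarrow> nat) \<times> (nat \<Rightarrow> nat) \<Rightarrow> nat set \<Rightarrow> nat set \<Rightarrow> nat set \<Rightarrow> bool" where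
  "enumerated_partition = (\<lambda>(a, b, c) A B C.
     partition3 A B C \<and> enumerates a A \<and> enumerates b B \<and> enumerates c C)"

text \<open>The subtractions are on natural numbers; none of them truncates for \<open>n \<ge> 1\<close>.\<close>

definition std1 :: "nat \<Rightarrow> nat" where
  "std1 n = 3 * n - n div 2 - 2"

definition std2 :: "nat \<Rightarrow> nat" where
  "std2 n = 3 * n - n div 2 - 1"

definition std3 :: "nat \<Rightarrow> nat" where
  "std3 n = 5 * n - 5"

definition equivalent_partitions ::
    "(nat \<Rightarrow> nat) \<times> (nat \<Rightarrow> nat) \<times> (nat \<Rightarrow> nat) \<Rightarrow>
     (nat \<Rightarrow> nat) \<times> (nat \<Rightarrow> nat) \<times> (nat \<Rightarrow> nat) \<Rightarrow> bool" where
  "equivalent_partitions = (\<lambda>(a, b, c) (d, e, f).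
     \<exists>N. \<forall>k>N. a k = d k \<and> b k = e k \<and> c k = f k)"

lemma standard_enumerated_partition:
  "enumerated_partition (std1, std2, std3) (std1 ` {1..}) (std2 ` {1..}) (std3 ` {1..})"
proof -
  have less: "std1 m < std1 n" "std2 m < std2 n" "std3 m < std3 n" if "1 \<le> m" "m < n" for m n
    using that by (simp_all add: std1_def std2_def std3_def)
  have inj: "inj_on std1 {1..}" "inj_on std2 {1..}" "inj_on std3 {1..}"
    using less by (auto intro!: linorder_inj_onI simp: order_less_le)
  have cover: "\<exists>n\<ge>1. x = std1 n \<or> x = std2 n \<or> x = std3 n" for x
  proof -
    define m where "m = x div 5"
    have "x = 5 * m \<or> x = 5 * m + 1 \<or> x = 5 * m + 2 \<or> x = 5 * m + 3 \<or> x = 5 * m + 4"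
      unfolding m_def by presburger
    moreover have "5 * m = std3 (m + 1)" "5 * m + 1 = std1 (2 * m + 1)"
      "5 * m + 2 = std2 (2 * m + 1)" "5 * m + 3 = std1 (2 * m + 2)" "5 * m + 4 = std2 (2 * m + 2)"
      by (simp_all add: std1_def std2_def std3_def)
    moreover have "m + 1 \<ge> 1" "2 * m + 1 \<ge> 1" "2 * m + 2 \<ge> 1"
      by simp_all
    ultimately show ?thesis
      by metis
  qed
  have mods: "std1 n mod 5 \<in> {1, 3}" "std2 n mod 5 \<in> {2, 4}" "std3 n mod 5 = 0"
    if "n \<ge> 1" for n
  proof -
    have "\<exists>m. n = 2 * m + 1 \<or> n = 2 * m + 2"
      using that by presburger
    then obtain m where "n = 2 * m + 1 \<or> n = 2 * m + 2" ..
    then have "std1 n = 1 + 5 * m \<and> std2 n = 2 + 5 * m \<or> std1 n = 3 + 5 * m \<and> std2 n = 4 + 5 * m"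
      by (auto simp: std1_def std2_def)
    then show "std1 n mod 5 \<in> {1, 3}" "std2 n mod 5 \<in> {2, 4}"
      unfolding insert_iff empty_iff by presburger+
    have "std3 n = 5 * (n - 1)"
      by (simp add: std3_def)
    then show "std3 n mod 5 = 0"
      by simp
  qed
  have disj: "std1 m \<noteq> std2 n \<and> std1 m \<noteq> std3 n \<and> std2 m \<noteq> std3 n"
    if "m \<ge> 1" "n \<ge> 1" for m n
    using mods[OF that(1)] mods[OF that(2)] by auto
  have "partition3 (std1 ` {1..}) (std2 ` {1..}) (std3 ` {1..})"
    unfolding partition3_def
  proof (intro conjI)
    show "std1 ` {1..} \<union> std2 ` {1..} \<union> std3 ` {1..} = UNIV"
      using cover by (fastforce simp: image_iff)
  qed (use disj in auto)
  then show ?thesis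
    using inj by (simp add: enumerated_partition_def enumerates_def bij_betw_def)
qed

end

theory Submission
  imports Defs
begin

text \<open>Apply to the standard partition the finitely supported permutation of the values
  \<open>(0 2 1)(9 11)(12 14 15 13)\<close>. A permutation of the values carries enumerated partitions to
  enumerated partitions, and one of finite support changes only finitely many terms.\<close>

text \<open>Surjectivity of \<open>p\<close> keeps the union equal to \<open>UNIV\<close>, and
  injectivity keeps the three images disjoint.\<close>

lemma enumerated_partition_comp_bij:
  assumes "enumerated_partition (a, b, c) A B C" and p: "bij p"
  shows "enumerated_partition (p \<circ> a, p \<circ> b, p \<circ> c) (p ` A) (p ` B) (p ` C)"
proof -
  have part: "partition3 A B C" and enum: "enumerates a A" "enumerates b B" "enumerates c C"
    using assms(1) by (simp_all add: enumerated_partition_def)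
  have "p ` A \<union> p ` B \<union> p ` C = UNIV"
    using part p by (metis bij_is_surj image_Un partition3_def)
  moreover have "p ` A \<inter> p ` B = {}" "p ` A \<inter> p ` C = {}" "p ` B \<inter> p ` C = {}"
    using part p by (simp_all add: partition3_def bij_is_inj flip: image_Int)
  ultimately have "partition3 (p ` A) (p ` B) (p ` C)"
    by (simp add: partition3_def)
  moreover have "enumerates (p \<circ> f) (p ` X)" if "enumerates f X" for f X
    using that bij_betw_subset[OF p subset_UNIV refl] bij_betw_trans
    unfolding enumerates_def by blast
  ultimately show ?thesis
    using enum by (simp add: enumerated_partition_def)
qed

lemma equivalent_partitions_comp:
  assumes "\<And>x. x > M \<Longrightarrow> p x = x"
    and "\<And>k. k > N \<Longrightarrow> a k > M" "\<And>k. k > N \<Longrightarrow> b k > M" "\<And>k. k > N \<Longrightarrow> c k > M"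
  shows "equivalent_partitions (p \<circ> a, p \<circ> b, p \<circ> c) (a, b, c)"
  using assms unfolding equivalent_partitions_def by (auto intro!: exI[of _ N])

theorem proposition1p4:
  shows "\<exists>A B C a b c.
    enumerated_partition (a, b, c) A B C \<and>
    (a 1, a 2, a 3, a 4, a 5) = (0, 3, 6, 8, 9) \<and>
    (b 1, b 2, b 3, b 4, b 5) = (1, 4, 7, 11, 14) \<and>
    (c 1, c 2, c 3, c 4) = (2, 5, 10, 13) \<and>
    equivalent_partitions (a, b, c) (std1, std2, std3)"
proof -
  \<comment> \<open>The prescribed terms force \<open>p\<close> at the 14 standard values of the
    same ranks: for instance \<open>std3 1 = 0\<close> must go to 2 and \<open>std1 5 = 11\<close>
    to 9. In 0..15 only 13 and 14 remain free, with images 12 and 15 left; sending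
    \<open>std1 6 = 13\<close> to 12 and \<open>std2 6 = 14\<close> to 15 keeps the new enumerations
    increasing.\<close>
  define p :: "nat \<Rightarrow> nat" where
    "p = id(0 := 2, 2 := 1, 1 := 0, 9 := 11, 11 := 9, 12 := 14, 14 := 15, 15 := 13, 13 := 12)"
  define q :: "nat \<Rightarrow> nat" where
    "q = id(2 := 0, 1 := 2, 0 := 1, 11 := 9, 9 := 11, 14 := 12, 15 := 14, 13 := 15, 12 := 13)"
  have "q \<circ> p = id" "p \<circ> q = id"
    by (auto simp: fun_eq_iff p_def q_def)
  then have "bij p"
    by (rule o_bij)
  then have "enumerated_partition (p \<circ> std1, p \<circ> std2, p \<circ> std3)
      (p ` std1 ` {1..}) (p ` std2 ` {1..}) (p ` std3 ` {1..})"
    by (rule enumerated_partition_comp_bij[OF standard_enumerated_partition])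
  moreover have "equivalent_partitions (p \<circ> std1, p \<circ> std2, p \<circ> std3) (std1, std2, std3)"
    \<comment> \<open>15 is the largest value that \<open>p\<close> moves. Rank 6 is the last with a
      moved term; from rank 7 on the terms are at least \<open>std1 7 = 16\<close>.\<close>
    by (rule equivalent_partitions_comp[where M = 15 and N = 6])
      (auto simp: p_def std1_def std2_def std3_def)
  moreover have "((p \<circ> std1) 1, (p \<circ> std1) 2, (p \<circ> std1) 3, (p \<circ> std1) 4, (p \<circ> std1) 5)
      = (0, 3, 6, 8, 9)"
    "((p \<circ> std2) 1, (p \<circ> std2) 2, (p \<circ> std2) 3, (p \<circ> std2) 4, (p \<circ> std2) 5)
      = (1, 4, 7, 11, 14)"
    "((p \<circ> std3) 1, (p \<circ> std3) 2, (p \<circ> std3) 3, (p \<circ> std3) 4) = (2, 5, 10, 13)"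
    by (simp_all add: p_def std1_def std2_def std3_def)
  ultimately show ?thesis
    by blast
qed

end
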